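(* Let $\mathcal{H}$ be a real Hilbert space, let $\tau>0$, and let $A:\mathcal{H}\to 2^{\mathcal{H}}$ and $B:\mathcal{H}\to 2^{\mathcal{H}}$ be maximally monotone. The Douglas–Rachford scheme $$z^{k+1} := z^k - J_{\tau B}(z^k) + J_{\tau A}\big(2J_{\tau B}(z^k)-z^k\big)$$ can be expressed as $$v^{k+1} = \big(\mathcal{I}+\mathcal{K}\mathcal{L}^{-1}\mathcal{K}^\top\big)^{-1}v^k,$$ where $$\mathcal{L}=\begin{bmatrix} B^{-1} & -\tau I\\ \tau I & A^{-1}\end{bmatrix}:\mathcal{H}\times\mathcal{H}\to 2^{\mathcal{H}}\times 2^{\mathcal{H}},\qquad \mathcal{K}=\sqrt{\tau}\begin{bmatrix} I & I\end{bmatrix}:\mathcal{H}\times\mathcal{H}\to\mathcal{H},$$ and the variable $v\in\mathcal{H}$ is linked to the variable $z$ of the Douglas–Rachford scheme and to the variable $x$ of the inclusion problem "find $x\in\mathcal{H}$ such that $0\in(A+B)x$" via $z^k=\sqrt{\tau}\,v^k$ and $x^k=J_{\tau B}(z^k)=J_{\tau B}(\sqrt{\tau}\,v^k)$.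
   Context: Monotone: $\langle x-y\,|\,u-v\rangle\ge0$ for all $(x,u),(y,v)$ in the graph; maximally monotone: monotone with no proper monotone extension of the graph. $I$ and $\mathcal{I}$ denote identity operators; $J_{\tau A}:=(\mathcal{I}+\tau A)^{-1}$; $A^{-1}$ is the set-valued inverse ($x\in A^{-1}u\iff u\in Ax$). Block notation: $\mathcal{L}(u,s)=(B^{-1}u-\tau s)\times(\tau u+A^{-1}s)$, $\mathcal{K}(u,s)=\sqrt{\tau}(u+s)$, and $\mathcal{K}^\top:\mathcal{H}\to\mathcal{H}\times\mathcal{H}$ is the adjoint, $\mathcal{K}^\top v=(\sqrt{\tau}v,\sqrt{\tau}v)$. $\mathcal{L}^{-1}$ is the set-valued inverse of $\mathcal{L}$. *)

theory Defs
  imports "HOL-Analysis.Analysis"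
begin

type_synonym ('a, 'b) setop = "'a \<Rightarrow> 'b set"

definition op_graph :: "('a, 'b) setop \<Rightarrow> ('a \<times> 'b) set" where
  "op_graph M = {(x, u). u \<in> M x}"

definition op_inverse :: "('a, 'b) setop \<Rightarrow> ('b, 'a) setop" where
  "op_inverse M u = {x. u \<in> M x}"

definition op_id :: "('a, 'a) setop" where
  "op_id x = {x}"

definition op_add :: "('a, 'b::plus) setop \<Rightarrow> ('a, 'b) setop \<Rightarrow> ('a, 'b) setop" where
  "op_add M N x = {a + b | a b. a \<in> M x \<and> b \<in> N x}"

definition op_scale :: "real \<Rightarrow> ('a, 'b::real_vector) setop \<Rightarrow> ('a, 'b) setop" where
  "op_scale c M x = (\<lambda>u. c *\<^sub>R u) ` M x"

definition monotone_op :: "('a::real_inner, 'a) setop \<Rightarrow> bool" where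
  "monotone_op M \<longleftrightarrow>
    (\<forall>x u y v. (x, u) \<in> op_graph M \<longrightarrow> (y, v) \<in> op_graph M \<longrightarrow> (x - y) \<bullet> (u - v) \<ge> 0)"

definition maximally_monotone :: "('a::real_inner, 'a) setop \<Rightarrow> bool" where
  "maximally_monotone M \<longleftrightarrow>
    monotone_op M \<and> (\<nexists>N. monotone_op N \<and> op_graph M \<subset> op_graph N)"

text \<open>
  An operator all of whose values are singletons is identified with a function;
  \<open>op_fun\<close> is meaningful only for such operators.
\<close>

definition is_map :: "('a, 'b) setop \<Rightarrow> bool" where
  "is_map M \<longleftrightarrow> (\<forall>x. \<exists>!y. y \<in> M x)"

definition op_fun :: "('a, 'b) setop \<Rightarrow> 'a \<Rightarrow> 'b" where
  "op_fun M x = (THE y. y \<in> M x)"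

definition resolvent_op :: "real \<Rightarrow> ('a::real_vector, 'a) setop \<Rightarrow> ('a, 'a) setop" where
  "resolvent_op \<tau> M = op_inverse (op_add op_id (op_scale \<tau> M))"

definition resolvent :: "real \<Rightarrow> ('a::real_vector, 'a) setop \<Rightarrow> 'a \<Rightarrow> 'a" where
  "resolvent \<tau> M = op_fun (resolvent_op \<tau> M)"

definition DR_step :: "real \<Rightarrow> ('a::real_vector, 'a) setop \<Rightarrow> ('a, 'a) setop \<Rightarrow> 'a \<Rightarrow> 'a" where
  "DR_step \<tau> A B z = z - resolvent \<tau> B z + resolvent \<tau> A (2 *\<^sub>R resolvent \<tau> B z - z)"

text \<open>
  The block operators: rows \<open>(B\<inverse>, - \<tau> I)\<close> and \<open>(\<tau> I, A\<inverse>)\<close>, and \<open>sqrt \<tau> (I, I)\<close>.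
\<close>

definition block_L ::
  "real \<Rightarrow> ('a::real_vector, 'a) setop \<Rightarrow> ('a, 'a) setop \<Rightarrow> ('a \<times> 'a, 'a \<times> 'a) setop" where
  "block_L \<tau> A B = (\<lambda>(u, s).
     {p - \<tau> *\<^sub>R s | p. p \<in> op_inverse B u} \<times> {\<tau> *\<^sub>R u + q | q. q \<in> op_inverse A s})"

definition block_K :: "real \<Rightarrow> 'a::real_vector \<times> 'a \<Rightarrow> 'a" where
  "block_K \<tau> = (\<lambda>(u, s). sqrt \<tau> *\<^sub>R (u + s))"

lemma adjoint_block_K:
  "adjoint (block_K \<tau>) = (\<lambda>v::'a::real_inner. (sqrt \<tau> *\<^sub>R v, sqrt \<tau> *\<^sub>R v))"
  by (rule adjoint_unique)
    (auto simp: block_K_def inner_prod_def inner_add_left algebra_simps)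

definition KLK ::
  "real \<Rightarrow> ('a::real_inner, 'a) setop \<Rightarrow> ('a, 'a) setop \<Rightarrow> ('a, 'a) setop" where
  "KLK \<tau> A B v = block_K \<tau> ` op_inverse (block_L \<tau> A B) (adjoint (block_K \<tau>) v)"

definition PPP_op ::
  "real \<Rightarrow> ('a::real_inner, 'a) setop \<Rightarrow> ('a, 'a) setop \<Rightarrow> ('a, 'a) setop" where
  "PPP_op \<tau> A B = op_inverse (op_add op_id (KLK \<tau> A B))"

end

theory Submission
  imports Defs
begin

text \<open>
  The resolvents are everywhere defined by Minty's theorem, which is proved with the Fitzpatrick
  function \<open>F (x, u) = sup {x \<bullet> b + a \<bullet> u - a \<bullet> b | b \<in> M a}\<close>: for maximally monotone \<open>M\<close> it satisfies
  \<open>F (x, u) \<ge> x \<bullet> u\<close>, with equality on the graph. The strongly convex function \<open>F + norm\<^sup>2 / 2\<close> has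
  a minimizer \<open>(x, u)\<close>, and its optimality condition says that \<open>(- u, - x)\<close> is monotonically related
  to the graph; hence \<open>(- u, - x)\<close> lies in the graph, and testing optimality there gives \<open>u = - x\<close>.

  For the scheme itself, \<open>w\<close> is a value of the proximal point operator at \<open>v\<close> iff there are \<open>u\<close>, \<open>s\<close>
  with \<open>u \<in> B p\<close>, \<open>s \<in> A q\<close> and \<open>v = w + sqrt \<tau> (u + s)\<close>, where \<open>p = sqrt \<tau> w + \<tau> s\<close> and
  \<open>q = sqrt \<tau> w - \<tau> u\<close>. With \<open>z = sqrt \<tau> v\<close> this reads \<open>z = p + \<tau> u\<close> and \<open>2 p - z = q + \<tau> s\<close>, that is,
  \<open>p\<close> and \<open>q\<close> are the two resolvent values, and \<open>sqrt \<tau> w = z - p + q\<close>.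
\<close>

section \<open>Minty's theorem\<close>

text \<open>Dividing by \<open>t\<close> and letting it decrease to 0 removes the quadratic term.
  This turns minimality along a segment into a first-order condition.\<close>

lemma le_from_quadratic_perturbation:
  fixes a b :: real
  assumes "\<And>t. 0 < t \<Longrightarrow> t < 1 \<Longrightarrow> 0 \<le> t * a + t\<^sup>2 * b"
  shows "0 \<le> a"
proof -
  have "((\<lambda>t. a + t * b) \<longlongrightarrow> a + 0 * b) (at_right 0)"
    by (intro tendsto_intros)
  moreover have "eventually (\<lambda>t. 0 \<le> a + t * b) (at_right 0)"
    unfolding eventually_at_right_field
  proof (intro exI[of _ 1] conjI allI impI)
    fix t :: real assume t: "0 < t" "t < 1"
    have "0 \<le> t * (a + t * b)"
      using assms[OF t] by (simp add: algebra_simps power2_eq_square)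
    with t show "0 \<le> a + t * b"
      by (simp add: zero_le_mult_iff)
  qed simp
  ultimately have "0 \<le> a + 0 * b"
    by (intro tendsto_lowerbound) auto
  then show ?thesis by simp
qed

text \<open>
  \<open>C\<close> plays the role of the epigraph of a closed convex function, which may take the value \<open>\<infinity>\<close>;
  the conclusion is the optimality condition for minimizing that function plus \<open>norm\<^sup>2 / 2\<close>.
\<close>

lemma epigraph_proximal_point:
  fixes C :: "('a::{real_inner, complete_space} \<times> real) set"
  assumes "closed C" "convex C" "C \<noteq> {}"
    and lower: "\<And>y r. (y, r) \<in> C \<Longrightarrow> m0 \<le> r + (norm y)\<^sup>2 / 2"
  shows "\<exists>(y0, r0)\<in>C. \<forall>(y, r)\<in>C. r0 \<le> r + y0 \<bullet> (y - y0)"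
proof -
  define g :: "'a \<times> real \<Rightarrow> real" where "g c = snd c + (norm (fst c))\<^sup>2 / 2" for c
  define m where "m = Inf (g ` C)"
  have bdd: "bdd_below (g ` C)"
    using lower by (auto intro!: bdd_belowI[of _ m0] simp: g_def)
  have m_le: "m \<le> g c" if "c \<in> C" for c
    unfolding m_def using that bdd by (intro cInf_lower) auto
  have "\<exists>c\<in>C. g c < m + inverse (real (Suc n))" for n
    using cInf_lessD[of "g ` C" "m + inverse (real (Suc n))"] \<open>C \<noteq> {}\<close> by (auto simp: m_def)
  then obtain c where c: "\<And>n. c n \<in> C" "\<And>n. g (c n) < m + inverse (real (Suc n))"
    by metis
  \<comment> \<open>The convexity defect of \<open>g\<close> is an exact identity, since
    \<open>g\<close> is linear in the second component. It serves twice: at \<open>t = 1/2\<close>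
    for the Cauchy property, and for small \<open>t\<close> for optimality.\<close>
  have g_mix: "g ((1 - t) *\<^sub>R d + t *\<^sub>R e) = (1 - t) * g d + t * g e
      - t * (1 - t) * (norm (fst d - fst e))\<^sup>2 / 2" for d e t
  proof -
    have "(norm ((1 - t) *\<^sub>R x + t *\<^sub>R y))\<^sup>2 =
        (1 - t) * (norm x)\<^sup>2 + t * (norm y)\<^sup>2 - t * (1 - t) * (norm (x - y))\<^sup>2" for x y :: 'a
      unfolding power2_norm_eq_inner inner_simps by (simp add: inner_commute algebra_simps)
    from this[of "fst d" "fst e"] show ?thesis
      by (simp add: g_def field_simps)
  qed
  \<comment> \<open>The midpoint of \<open>d\<close> and \<open>e\<close> has value at least
    \<open>m\<close>, so near-minimizers have close first components. This replaces
    compactness.\<close>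
  have gap: "(norm (fst d - fst e))\<^sup>2 \<le> 4 * (g d - m) + 4 * (g e - m)"
    if "d \<in> C" "e \<in> C" for d e
  proof -
    have "(1 - 1/2) *\<^sub>R d + (1/2) *\<^sub>R e \<in> C"
      using \<open>convex C\<close> that by (intro convexD) auto
    from m_le[OF this] show ?thesis
      unfolding g_mix by simp
  qed
  have g_lim: "(\<lambda>n. g (c n)) \<longlonglongrightarrow> m"
  proof (rule tendsto_sandwich)
    show "(\<lambda>n. m) \<longlonglongrightarrow> m" by simp
    show "(\<lambda>n. m + inverse (real (Suc n))) \<longlonglongrightarrow> m"
      using tendsto_add[OF tendsto_const LIMSEQ_inverse_real_of_nat, of m] by simp
  qed (auto intro!: always_eventually m_le c(1) less_imp_le[OF c(2)] simp del: of_nat_Suc)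
  have "Cauchy (\<lambda>n. fst (c n))"
  proof (rule metric_CauchyI)
    fix e :: real assume "0 < e"
    \<comment> \<open>Two values below \<open>m + e^2 / 8\<close> make the bound in
      \<open>gap\<close> exactly \<open>e^2\<close>.\<close>
    then have "eventually (\<lambda>n. g (c n) < m + e\<^sup>2 / 8) sequentially"
      by (intro order_tendstoD[OF g_lim]) auto
    then obtain N where N: "\<And>n. n \<ge> N \<Longrightarrow> g (c n) < m + e\<^sup>2 / 8"
      by (auto simp: eventually_sequentially)
    have "dist (fst (c i)) (fst (c j)) < e" if "i \<ge> N" "j \<ge> N" for i j
    proof -
      have "(norm (fst (c i) - fst (c j)))\<^sup>2 < e\<^sup>2"
        using gap[OF c(1) c(1), of i j] N[OF that(1)] N[OF that(2)] by argo
      then show ?thesis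
        using \<open>0 < e\<close> by (simp add: dist_norm power_less_imp_less_base)
    qed
    then show "\<exists>N. \<forall>i\<ge>N. \<forall>j\<ge>N. dist (fst (c i)) (fst (c j)) < e" by blast
  qed
  then obtain y0 where y0: "(\<lambda>n. fst (c n)) \<longlonglongrightarrow> y0"
    by (auto simp: Cauchy_convergent_iff convergent_def)
  \<comment> \<open>This value is forced by \<open>g (y0, r0) = m\<close>.\<close>
  define r0 where "r0 = m - (norm y0)\<^sup>2 / 2"
  have "(\<lambda>n. g (c n) - (norm (fst (c n)))\<^sup>2 / 2) \<longlonglongrightarrow> r0"
    unfolding r0_def by (intro tendsto_intros g_lim y0) auto
  then have "(\<lambda>n. snd (c n)) \<longlonglongrightarrow> r0"
    by (simp add: g_def)
  from tendsto_Pair[OF y0 this] have "c \<longlonglongrightarrow> (y0, r0)" by simp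
  with \<open>closed C\<close> c(1) have mem: "(y0, r0) \<in> C"
    by (meson closed_sequentially)
  have g0: "g (y0, r0) = m" by (simp add: g_def r0_def)
  have "r0 \<le> r + y0 \<bullet> (y - y0)" if yr: "(y, r) \<in> C" for y r
  proof -
    \<comment> \<open>Moving from the minimizer towards \<open>(y, r)\<close> by the fraction
      \<open>t\<close> cannot go below \<open>m\<close>; \<open>g_mix\<close> splits the change into
      a linear and a quadratic part.\<close>
    have "0 \<le> t * (g (y, r) - m - (norm (y0 - y))\<^sup>2 / 2) + t\<^sup>2 * ((norm (y0 - y))\<^sup>2 / 2)"
      if "0 < t" "t < 1" for t
    proof -
      have "(1 - t) *\<^sub>R (y0, r0) + t *\<^sub>R (y, r) \<in> C"
        using \<open>convex C\<close> mem yr that by (intro convexD) auto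
      from m_le[OF this] show ?thesis
        unfolding g_mix g0 by (simp add: algebra_simps power2_eq_square diff_divide_distrib)
    qed
    then have "0 \<le> g (y, r) - m - (norm (y0 - y))\<^sup>2 / 2"
      by (rule le_from_quadratic_perturbation)
    then show ?thesis
      by (simp add: g_def r0_def power2_norm_eq_inner inner_simps inner_commute field_simps)
  qed
  with mem show ?thesis by blast
qed

text \<open>One-point extensions decide maximality: a pair monotonically related to the whole graph
  can be adjoined to it, and every pair of a monotone extension is so related.\<close>

lemma maximally_monotone_iff:
  "maximally_monotone M \<longleftrightarrow>
    (\<forall>x u. u \<in> M x \<longleftrightarrow> (\<forall>y v. v \<in> M y \<longrightarrow> 0 \<le> (x - y) \<bullet> (u - v)))"
  (is "_ \<longleftrightarrow> ?R")
proof
  assume max: "maximally_monotone M"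
  then have mono: "0 \<le> (x - y) \<bullet> (u - v)" if "u \<in> M x" "v \<in> M y" for x y u v
    using that by (auto simp: maximally_monotone_def monotone_op_def op_graph_def)
  have "u \<in> M x" if rel: "\<forall>y v. v \<in> M y \<longrightarrow> 0 \<le> (x - y) \<bullet> (u - v)" for x u
  proof (rule ccontr)
    assume nin: "u \<notin> M x"
    define N where "N = M (x := insert u (M x))"
    have N: "v \<in> N y \<longleftrightarrow> v \<in> M y \<or> y = x \<and> v = u" for y v
      by (auto simp: N_def)
    have rel': "0 \<le> (y - x) \<bullet> (v - u)" if "v \<in> M y" for y v
      using rel that by (metis inner_minus_left inner_minus_right minus_diff_eq)
    have "monotone_op N"
      unfolding monotone_op_def op_graph_def using mono rel rel' by (auto simp: N)
    moreover have "op_graph M \<subset> op_graph N"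
      using nin by (auto simp: op_graph_def N)
    ultimately show False
      using max by (auto simp: maximally_monotone_def)
  qed
  with mono show ?R by blast
next
  assume R: ?R
  have "op_graph N \<subseteq> op_graph M" if "monotone_op N" "op_graph M \<subseteq> op_graph N" for N
  proof clarify
    fix x u assume "(x, u) \<in> op_graph N"
    with that have "\<forall>y v. v \<in> M y \<longrightarrow> 0 \<le> (x - y) \<bullet> (u - v)"
      unfolding monotone_op_def op_graph_def by blast
    then have "u \<in> M x" using R by blast
    then show "(x, u) \<in> op_graph M" by (simp add: op_graph_def)
  qed
  moreover have "monotone_op M"
    unfolding monotone_op_def op_graph_def using R by blast
  ultimately show "maximally_monotone M"
    by (auto simp: maximally_monotone_def)
qed

lemma maximally_monotoneD:
  "maximally_monotone M \<Longrightarrow> u \<in> M x \<Longrightarrow> v \<in> M y \<Longrightarrow> 0 \<le> (x - y) \<bullet> (u - v)"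
  unfolding maximally_monotone_iff by blast

lemma maximally_monotone_memI:
  assumes "maximally_monotone M" "\<And>y v. v \<in> M y \<Longrightarrow> 0 \<le> (x - y) \<bullet> (u - v)"
  shows "u \<in> M x"
  using assms unfolding maximally_monotone_iff by blast

text \<open>Reduces solving \<open>z = x + \<tau> *\<^sub>R u\<close> with
  \<open>u \<in> M x\<close> to finding \<open>x\<close> with \<open>- x\<close> in the value at
  \<open>x\<close> of the transformed operator.\<close>

lemma maximally_monotone_affine:
  assumes "maximally_monotone M" "0 < \<tau>"
  shows "maximally_monotone (\<lambda>x. (\<lambda>u. \<tau> *\<^sub>R u - z) ` M x)"
proof -
  have mem: "u \<in> (\<lambda>u. \<tau> *\<^sub>R u - z) ` S \<longleftrightarrow> (1 / \<tau>) *\<^sub>R (u + z) \<in> S" for u S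
    using \<open>0 < \<tau>\<close> by (auto simp: image_iff intro!: bexI[of _ "(1 / \<tau>) *\<^sub>R (u + z)"])
  have *: "0 \<le> (x - y) \<bullet> (u - (\<tau> *\<^sub>R v - z)) \<longleftrightarrow> 0 \<le> (x - y) \<bullet> ((1 / \<tau>) *\<^sub>R (u + z) - v)" for x y u v
  proof -
    have "u - (\<tau> *\<^sub>R v - z) = \<tau> *\<^sub>R ((1 / \<tau>) *\<^sub>R (u + z) - v)"
      using \<open>0 < \<tau>\<close> by (simp add: algebra_simps)
    then show ?thesis
      using \<open>0 < \<tau>\<close> by (simp add: zero_le_mult_iff)
  qed
  have related: "(\<forall>y v. v \<in> (\<lambda>u. \<tau> *\<^sub>R u - z) ` M y \<longrightarrow> 0 \<le> (x - y) \<bullet> (u - v)) \<longleftrightarrow>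
      (\<forall>y v. v \<in> M y \<longrightarrow> 0 \<le> (x - y) \<bullet> ((1 / \<tau>) *\<^sub>R (u + z) - v))" for x u
    by (auto simp flip: *)
  show ?thesis
    using assms(1) unfolding maximally_monotone_iff related unfolding mem by blast
qed

lemma Minty_zero:
  fixes M :: "('h::{real_inner, complete_space}, 'h) setop"
  assumes "maximally_monotone M"
  obtains x where "- x \<in> M x"
proof -
  note mono = maximally_monotoneD[OF assms] and memI = maximally_monotone_memI[OF assms]
  \<comment> \<open>The epigraph of the Fitzpatrick function, which is a set even where the supremum
    is infinite. As an intersection of closed half-spaces it is closed and convex.\<close>
  define C :: "(('h \<times> 'h) \<times> real) set"
    where "C = {((x, u), r). \<forall>a b. b \<in> M a \<longrightarrow> x \<bullet> b + a \<bullet> u - a \<bullet> b \<le> r}"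
  have C_Int: "C = (\<Inter>(a, b)\<in>{(a, b). b \<in> M a}.
      {c. fst (fst c) \<bullet> b + a \<bullet> snd (fst c) - a \<bullet> b \<le> snd c})"
    by (auto simp: C_def)
  have "closed C"
    unfolding C_Int by (auto intro!: closed_INT closed_Collect_le continuous_intros)
  have "convex C"
    unfolding C_Int
  proof (intro convex_INT, clarify)
    fix a b
    show "convex {c :: ('h \<times> 'h) \<times> real. fst (fst c) \<bullet> b + a \<bullet> snd (fst c) - a \<bullet> b \<le> snd c}"
    proof (rule convexI, clarsimp)
      fix x u x' u' :: 'h and r r' s t :: real
      assume 1: "x \<bullet> b + a \<bullet> u - a \<bullet> b \<le> r" "x' \<bullet> b + a \<bullet> u' - a \<bullet> b \<le> r'"
        and st: "0 \<le> s" "0 \<le> t" "s + t = 1"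
      have "s * (x \<bullet> b + a \<bullet> u - a \<bullet> b) + t * (x' \<bullet> b + a \<bullet> u' - a \<bullet> b) \<le> s * r + t * r'"
        using 1 st by (intro add_mono mult_left_mono)
      moreover have "s * (a \<bullet> b) + t * (a \<bullet> b) = a \<bullet> b"
        using st by (metis distrib_right mult_1)
      ultimately show "(s *\<^sub>R x + t *\<^sub>R x') \<bullet> b + a \<bullet> (s *\<^sub>R u + t *\<^sub>R u') - a \<bullet> b \<le> s * r + t * r'"
        by (simp add: inner_simps algebra_simps)
    qed
  qed
  have graph_C: "((a, b), a \<bullet> b) \<in> C" if "b \<in> M a" for a b
  proof -
    have "a \<bullet> v + y \<bullet> b - y \<bullet> v \<le> a \<bullet> b" if "v \<in> M y" for y v
      using mono[OF \<open>b \<in> M a\<close> that] by (simp add: inner_diff_left inner_diff_right)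
    then show ?thesis by (simp add: C_def)
  qed
  \<comment> \<open>With an empty graph, \<open>(0, 0)\<close> would be vacuously related to it and
    hence belong to it.\<close>
  have "\<exists>a b. b \<in> M a"
    using memI[of 0 0] by metis
  then have "C \<noteq> {}"
    using graph_C by blast
  \<comment> \<open>On the graph, test with \<open>(x, u)\<close> itself. Off it, maximality
    supplies \<open>(a, b)\<close> with \<open>(x - a) \<bullet> (u - b) < 0\<close>, which makes
    the affine function of \<open>(a, b)\<close> exceed \<open>x \<bullet> u\<close>.\<close>
  have le_C: "x \<bullet> u \<le> r" if "((x, u), r) \<in> C" for x u r
  proof (cases "u \<in> M x")
    case True
    with that have "x \<bullet> u + x \<bullet> u - x \<bullet> u \<le> r"
      unfolding C_def by blast
    then show ?thesis by simp
  next
    case False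
    then obtain a b where "b \<in> M a" "(x - a) \<bullet> (u - b) < 0"
      using memI[of x u] by (meson not_le)
    moreover from this have "x \<bullet> b + a \<bullet> u - a \<bullet> b \<le> r"
      using that by (auto simp: C_def)
    ultimately show ?thesis by (simp add: inner_simps)
  qed
  have norm_sum: "(norm (x + u))\<^sup>2 = (norm x)\<^sup>2 + (norm u)\<^sup>2 + 2 * (x \<bullet> u)" for x u :: 'h
    by (simp add: power2_norm_eq_inner inner_simps inner_commute)
  have lower: "0 \<le> r + (norm y)\<^sup>2 / 2" if "(y, r) \<in> C" for y r
  proof (cases y)
    case (Pair x u)
    then have "(norm y)\<^sup>2 = (norm x)\<^sup>2 + (norm u)\<^sup>2"
      by (simp add: norm_Pair)
    moreover have "x \<bullet> u \<le> r"
      using le_C that Pair by simp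
    ultimately show ?thesis
      using norm_sum[of x u] zero_le_power2[of "norm (x + u)"] by argo
  qed
  obtain y0 r0 where y0: "(y0, r0) \<in> C"
    and opt: "\<And>y r. (y, r) \<in> C \<Longrightarrow> r0 \<le> r + y0 \<bullet> (y - y0)"
    using epigraph_proximal_point[OF \<open>closed C\<close> \<open>convex C\<close> \<open>C \<noteq> {}\<close> lower] by blast
  obtain x u where xu: "y0 = (x, u)" by (cases y0)
  \<comment> \<open>Optimality is tested at graph points. Together with
    \<open>x \<bullet> u \<le> r0\<close>, the leftover terms complete the square of
    \<open>x + u\<close>.\<close>
  have rel: "(norm (x + u))\<^sup>2 \<le> (- u - a) \<bullet> (- x - b)" if "b \<in> M a" for a b
  proof -
    have "r0 \<le> a \<bullet> b + (x \<bullet> (a - x) + u \<bullet> (b - u))"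
      using opt[OF graph_C[OF that]] by (simp add: xu)
    moreover have "x \<bullet> u \<le> r0"
      using le_C y0 by (simp add: xu)
    moreover have "(- u - a) \<bullet> (- x - b) =
        a \<bullet> b + (x \<bullet> (a - x) + u \<bullet> (b - u)) + (norm x)\<^sup>2 + (norm u)\<^sup>2 + x \<bullet> u"
      by (simp add: power2_norm_eq_inner inner_diff_left inner_diff_right inner_commute)
    ultimately show ?thesis
      using norm_sum[of x u] by argo
  qed
  have "- x \<in> M (- u)"
    by (rule memI) (rule order_trans[OF zero_le_power2 rel])
  \<comment> \<open>At \<open>a = - u\<close>, \<open>b = - x\<close> the right-hand side of
    \<open>rel\<close> vanishes.\<close>
  moreover from rel[OF this] have "x + u = 0"
    by simp
  ultimately show thesis
    using that[of x] by (simp add: add_eq_0_iff)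
qed

section \<open>Resolvents\<close>

lemma mem_resolvent_op_iff: "x \<in> resolvent_op \<tau> M z \<longleftrightarrow> (\<exists>u\<in>M x. z = x + \<tau> *\<^sub>R u)"
  by (auto simp: resolvent_op_def op_inverse_def op_add_def op_id_def op_scale_def)

lemma op_fun_mem: "is_map M \<Longrightarrow> op_fun M x \<in> M x"
  using theI'[of "\<lambda>y. y \<in> M x"] by (simp add: is_map_def op_fun_def)

lemma op_fun_eq_iff: "is_map M \<Longrightarrow> op_fun M x = y \<longleftrightarrow> y \<in> M x"
  using op_fun_mem[of M x] unfolding is_map_def by metis

text \<open>Existence is \<open>Minty_zero\<close> for the operator shifted by \<open>z\<close>. For
  uniqueness, monotonicity applied to two solutions gives
  \<open>0 \<le> - ((x - y) \<bullet> (x - y))\<close>.\<close>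

lemma is_map_resolvent_op:
  fixes M :: "('h::{real_inner, complete_space}, 'h) setop"
  assumes max: "maximally_monotone M" and "0 < \<tau>"
  shows "is_map (resolvent_op \<tau> M)"
  unfolding is_map_def
proof
  fix z
  show "\<exists>!x. x \<in> resolvent_op \<tau> M z"
  proof (rule ex_ex1I)
    obtain x where "- x \<in> (\<lambda>u. \<tau> *\<^sub>R u - z) ` M x"
      using Minty_zero[OF maximally_monotone_affine[OF assms]] by blast
    then show "\<exists>x. x \<in> resolvent_op \<tau> M z"
      unfolding mem_resolvent_op_iff by (auto simp: algebra_simps intro!: exI[of _ x])
  next
    fix x y assume "x \<in> resolvent_op \<tau> M z" "y \<in> resolvent_op \<tau> M z"
    then obtain u v where u: "u \<in> M x" and v: "v \<in> M y" and eq: "x + \<tau> *\<^sub>R u = y + \<tau> *\<^sub>R v"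
      unfolding mem_resolvent_op_iff by metis
    have "0 \<le> \<tau> * ((x - y) \<bullet> (u - v))"
      using maximally_monotoneD[OF max u v] \<open>0 < \<tau>\<close> by simp
    also have "\<dots> = (x - y) \<bullet> (\<tau> *\<^sub>R u - \<tau> *\<^sub>R v)"
      by (simp flip: scaleR_diff_right)
    also have "\<tau> *\<^sub>R u - \<tau> *\<^sub>R v = - (x - y)"
      using eq by (simp add: algebra_simps)
    finally have "(x - y) \<bullet> (x - y) \<le> 0"
      by (simp only: inner_minus_right neg_0_le_iff_le)
    then show "x = y"
      by (metis inner_gt_zero_iff not_le eq_iff_diff_eq_0)
  qed
qed

lemma resolvent_eq_iff:
  assumes "is_map (resolvent_op \<tau> M)"
  shows "resolvent \<tau> M z = x \<longleftrightarrow> (\<exists>u\<in>M x. z = x + \<tau> *\<^sub>R u)"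
  unfolding resolvent_def op_fun_eq_iff[OF assms] mem_resolvent_op_iff ..

section \<open>The proximal point operator\<close>

lemma mem_PPP_op_iff:
  "w \<in> PPP_op \<tau> A B v \<longleftrightarrow> (\<exists>u s. u \<in> B (sqrt \<tau> *\<^sub>R w + \<tau> *\<^sub>R s) \<and> s \<in> A (sqrt \<tau> *\<^sub>R w - \<tau> *\<^sub>R u)
     \<and> v = w + sqrt \<tau> *\<^sub>R (u + s))"
proof -
  \<comment> \<open>Both components of the adjoint at \<open>w\<close> equal
    \<open>c = sqrt \<tau> *\<^sub>R w\<close>, so each row can be solved for the point at which
    \<open>B\<close> or \<open>A\<close> is evaluated.\<close>
  have L: "(u, s) \<in> op_inverse (block_L \<tau> A B) (c, c) \<longleftrightarrow>
      u \<in> B (c + \<tau> *\<^sub>R s) \<and> s \<in> A (c - \<tau> *\<^sub>R u)" for u s c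
  proof -
    have "c = p - \<tau> *\<^sub>R s \<longleftrightarrow> p = c + \<tau> *\<^sub>R s" for p
      by (metis eq_diff_eq)
    moreover have "c = \<tau> *\<^sub>R u + q \<longleftrightarrow> q = c - \<tau> *\<^sub>R u" for q
      by (metis eq_diff_eq add.commute)
    ultimately show ?thesis
      by (simp add: op_inverse_def block_L_def)
  qed
  have "k \<in> KLK \<tau> A B w \<longleftrightarrow> (\<exists>u s. u \<in> B (sqrt \<tau> *\<^sub>R w + \<tau> *\<^sub>R s) \<and>
      s \<in> A (sqrt \<tau> *\<^sub>R w - \<tau> *\<^sub>R u) \<and> k = sqrt \<tau> *\<^sub>R (u + s))" for k
    unfolding KLK_def adjoint_block_K by (simp add: image_iff Bex_def L block_K_def conj_assoc)
  moreover have "w \<in> PPP_op \<tau> A B v \<longleftrightarrow> (\<exists>k \<in> KLK \<tau> A B w. v = w + k)"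
    by (auto simp: PPP_op_def op_inverse_def op_add_def op_id_def)
  ultimately show ?thesis by (auto simp: Bex_def)
qed

lemma mem_PPP_op_iff_DR_step:
  assumes "0 < \<tau>" and A: "is_map (resolvent_op \<tau> A)" and B: "is_map (resolvent_op \<tau> B)"
  shows "w \<in> PPP_op \<tau> A B v \<longleftrightarrow> sqrt \<tau> *\<^sub>R w = DR_step \<tau> A B (sqrt \<tau> *\<^sub>R v)"
proof -
  define z where "z = sqrt \<tau> *\<^sub>R v"
  have scale: "v = w + sqrt \<tau> *\<^sub>R d \<longleftrightarrow> z = sqrt \<tau> *\<^sub>R w + \<tau> *\<^sub>R d" for d
  proof -
    have sq: "sqrt \<tau> * sqrt \<tau> = \<tau>"
      using \<open>0 < \<tau>\<close> by simp
    have "v = w + sqrt \<tau> *\<^sub>R d \<longleftrightarrow> sqrt \<tau> *\<^sub>R v = sqrt \<tau> *\<^sub>R (w + sqrt \<tau> *\<^sub>R d)"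
      using \<open>0 < \<tau>\<close> by (simp del: scaleR_add_right)
    also have "\<dots> \<longleftrightarrow> z = sqrt \<tau> *\<^sub>R w + \<tau> *\<^sub>R d"
      by (simp only: z_def scaleR_add_right scaleR_scaleR sq)
    finally show ?thesis .
  qed
  show ?thesis
    unfolding z_def[symmetric]
  proof
    assume "w \<in> PPP_op \<tau> A B v"
    then obtain u s where u: "u \<in> B (sqrt \<tau> *\<^sub>R w + \<tau> *\<^sub>R s)" and s: "s \<in> A (sqrt \<tau> *\<^sub>R w - \<tau> *\<^sub>R u)"
      and z: "z = sqrt \<tau> *\<^sub>R w + \<tau> *\<^sub>R (u + s)"
      unfolding mem_PPP_op_iff scale by blast
    have p: "resolvent \<tau> B z = sqrt \<tau> *\<^sub>R w + \<tau> *\<^sub>R s"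
      unfolding resolvent_eq_iff[OF B] using u z by (auto simp: algebra_simps)
    have "resolvent \<tau> A (2 *\<^sub>R resolvent \<tau> B z - z) = sqrt \<tau> *\<^sub>R w - \<tau> *\<^sub>R u"
      unfolding resolvent_eq_iff[OF A] p unfolding z scaleR_2 using s
      by (intro bexI[of _ s]) (auto simp: algebra_simps)
    with p z show "sqrt \<tau> *\<^sub>R w = DR_step \<tau> A B z"
      by (simp add: DR_step_def algebra_simps)
  next
    assume w: "sqrt \<tau> *\<^sub>R w = DR_step \<tau> A B z"
    define p where "p = resolvent \<tau> B z"
    define q where "q = resolvent \<tau> A (2 *\<^sub>R p - z)"
    \<comment> \<open>The resolvent equations, read at the resolvent values themselves, yield the
      witnesses \<open>u\<close> and \<open>s\<close>.\<close>
    obtain u where u: "u \<in> B p" "z = p + \<tau> *\<^sub>R u"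
      using resolvent_eq_iff[OF B] p_def by metis
    obtain s where s: "s \<in> A q" "2 *\<^sub>R p - z = q + \<tau> *\<^sub>R s"
      using resolvent_eq_iff[OF A] q_def by metis
    have w': "sqrt \<tau> *\<^sub>R w = z - p + q"
      using w by (simp add: DR_step_def p_def q_def)
    have "sqrt \<tau> *\<^sub>R w - \<tau> *\<^sub>R u = q"
      using w' u by simp
    moreover have p: "sqrt \<tau> *\<^sub>R w + \<tau> *\<^sub>R s = p"
    proof -
      have "sqrt \<tau> *\<^sub>R w + \<tau> *\<^sub>R s = z - p + (q + \<tau> *\<^sub>R s)"
        by (simp add: w')
      also have "\<dots> = p"
        by (simp add: scaleR_2 flip: s(2))
      finally show ?thesis .
    qed
    moreover have "z = sqrt \<tau> *\<^sub>R w + \<tau> *\<^sub>R (u + s)"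
      using p u(2) by (simp add: algebra_simps)
    ultimately show "w \<in> PPP_op \<tau> A B v"
      unfolding mem_PPP_op_iff scale using u s by metis
  qed
qed

text \<open>A zero splits as \<open>b \<in> B x\<close>, \<open>- b \<in> A x\<close> and gives the
  fixed point \<open>x + \<tau> *\<^sub>R b\<close>. Conversely, at a fixed point both resolvents
  return \<open>x\<close>, and adding their equations gives
  \<open>\<tau> *\<^sub>R (a + b) = 0\<close>.\<close>

lemma zero_mem_op_add_iff:
  assumes "0 < \<tau>" and A: "is_map (resolvent_op \<tau> A)" and B: "is_map (resolvent_op \<tau> B)"
  shows "0 \<in> op_add A B x \<longleftrightarrow> (\<exists>z. z = DR_step \<tau> A B z \<and> x = resolvent \<tau> B z)"
proof
  assume "0 \<in> op_add A B x"
  then obtain a b where "a \<in> A x" "b \<in> B x" "a + b = 0"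
    by (auto simp: op_add_def)
  then have b: "b \<in> B x" "- b \<in> A x"
    by (metis minus_unique add.commute)+
  define z where "z = x + \<tau> *\<^sub>R b"
  have "resolvent \<tau> B z = x"
    unfolding resolvent_eq_iff[OF B] using b by (auto simp: z_def)
  moreover have "resolvent \<tau> A (2 *\<^sub>R x - z) = x"
    unfolding resolvent_eq_iff[OF A]
    using b by (intro bexI[of _ "- b"]) (auto simp: z_def scaleR_2)
  ultimately show "\<exists>z. z = DR_step \<tau> A B z \<and> x = resolvent \<tau> B z"
    by (intro exI[of _ z]) (simp add: DR_step_def)
next
  assume "\<exists>z. z = DR_step \<tau> A B z \<and> x = resolvent \<tau> B z"
  then obtain z where x: "resolvent \<tau> B z = x" and "z = DR_step \<tau> A B z" by blast
  then have "resolvent \<tau> A (2 *\<^sub>R x - z) = x"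
    by (simp add: DR_step_def algebra_simps)
  then obtain a where a: "a \<in> A x" "2 *\<^sub>R x - z = x + \<tau> *\<^sub>R a"
    unfolding resolvent_eq_iff[OF A] by blast
  obtain b where b: "b \<in> B x" "z = x + \<tau> *\<^sub>R b"
    using x unfolding resolvent_eq_iff[OF B] by blast
  have "\<tau> *\<^sub>R (a + b) = 0"
    using a(2) b(2) by (simp add: algebra_simps scaleR_2)
  then have "a + b = 0"
    using \<open>0 < \<tau>\<close> by simp
  then show "0 \<in> op_add A B x"
    unfolding op_add_def using a b by force
qed

theorem proposition2p2:
  fixes A B :: "('h::{real_inner, complete_space}, 'h) setop"
    and \<tau> :: real
  assumes "\<tau> > 0"
    and "maximally_monotone A"
    and "maximally_monotone B"
  shows "is_map (resolvent_op \<tau> A) \<and> is_map (resolvent_op \<tau> B) \<and> is_map (PPP_op \<tau> A B)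
    \<and> (\<forall>z v x :: nat \<Rightarrow> 'h. (\<forall>k. z k = sqrt \<tau> *\<^sub>R v k) \<longrightarrow>
         ((\<forall>k. z (Suc k) = DR_step \<tau> A B (z k) \<and> x k = resolvent \<tau> B (z k)) \<longleftrightarrow>
          (\<forall>k. v (Suc k) = op_fun (PPP_op \<tau> A B) (v k) \<and>
               x k = resolvent \<tau> B (sqrt \<tau> *\<^sub>R v k))))
    \<and> (\<forall>x. 0 \<in> op_add A B x \<longleftrightarrow>
         (\<exists>v. v = op_fun (PPP_op \<tau> A B) v \<and> x = resolvent \<tau> B (sqrt \<tau> *\<^sub>R v)))"
proof -
  have A: "is_map (resolvent_op \<tau> A)" and B: "is_map (resolvent_op \<tau> B)"
    using assms is_map_resolvent_op by blast+
  note mem = mem_PPP_op_iff_DR_step[OF \<open>\<tau> > 0\<close> A B]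
  \<comment> \<open>Scaling by \<open>sqrt \<tau>\<close> is a bijection, so \<open>PPP_op\<close>
    inherits single-valuedness from \<open>DR_step\<close>, and every fixed point \<open>z\<close>
    comes from some \<open>v\<close>.\<close>
  have ex: "\<exists>w. sqrt \<tau> *\<^sub>R w = y" for y :: 'h
    using \<open>\<tau> > 0\<close> by (intro exI[of _ "(1 / sqrt \<tau>) *\<^sub>R y"]) simp
  have P: "is_map (PPP_op \<tau> A B)"
    unfolding is_map_def mem
  proof (intro allI ex_ex1I ex)
    fix v w w' :: 'h
    assume "sqrt \<tau> *\<^sub>R w = DR_step \<tau> A B (sqrt \<tau> *\<^sub>R v)" "sqrt \<tau> *\<^sub>R w' = DR_step \<tau> A B (sqrt \<tau> *\<^sub>R v)"
    then have "sqrt \<tau> *\<^sub>R w = sqrt \<tau> *\<^sub>R w'" by simp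
    then show "w = w'" using \<open>\<tau> > 0\<close> by simp
  qed
  have step: "w = op_fun (PPP_op \<tau> A B) v \<longleftrightarrow> sqrt \<tau> *\<^sub>R w = DR_step \<tau> A B (sqrt \<tau> *\<^sub>R v)" for v w
    using op_fun_eq_iff[OF P] mem by metis
  have "0 \<in> op_add A B x \<longleftrightarrow>
      (\<exists>v. v = op_fun (PPP_op \<tau> A B) v \<and> x = resolvent \<tau> B (sqrt \<tau> *\<^sub>R v))" for x
    unfolding step zero_mem_op_add_iff[OF \<open>\<tau> > 0\<close> A B] using ex by metis
  with A B P show ?thesis
    by (simp add: step)
qed

end
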